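(* Let $p$ be a prime and let $r$ be a positive integer that is a quadratic nonresidue modulo $p$. Then for each integer $n\ge 0$ and each $k\in\{1,2,3,4\}$, $$\overline{SOME}\bigl(4^{k-1}(pn+r)\bigr)\equiv 0\pmod{2^{2k+1}}.$$
   Context: An overpartition of a nonnegative integer $n$ is a partition of $n$ in which the first occurrence of each distinct part may be overlined (or not). For $n\ge 0$, $\overline{SOME}(n)$ denotes the sum, over all overpartitions $\lambda$ of $n$, of (the sum of the odd parts of $\lambda$) minus (the sum of the even parts of $\lambda$), where parts are counted with multiplicity and an overlined part counts with its numerical size. *)

theory Defs
  imports "HOL-Number_Theory.Number_Theory" "HOL-Library.Multiset"
begin

definition is_partition :: "nat \<Rightarrow> nat multiset \<Rightarrow> bool" where
  "is_partition n M \<longleftrightarrow> 0 \<notin># M \<and> sum_mset M = n"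

(* An overpartition is a pair (M, S): M is the multiset of parts (with their numerical
   sizes) and S is the set of those part sizes whose first occurrence is overlined. *)
definition overpartitions :: "nat \<Rightarrow> (nat multiset \<times> nat set) set" where
  "overpartitions n = {(M, S). is_partition n M \<and> S \<subseteq> set_mset M}"

definition odd_minus_even :: "nat multiset \<Rightarrow> int" where
  "odd_minus_even M =
     int (sum_mset (filter_mset odd M)) - int (sum_mset (filter_mset even M))"

definition some_bar :: "nat \<Rightarrow> int" where
  "some_bar n = (\<Sum>(M, S)\<in>overpartitions n. odd_minus_even M)"

(* The sum defining some_bar is a genuine finite sum. *)

lemma size_le_sum_mset: "0 \<notin># M \<Longrightarrow> size M \<le> sum_mset M" for M :: "nat multiset"
  by (induction M) auto

lemma finite_is_partition: "finite {M. is_partition n M}"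
proof (rule finite_subset)
  show "{M. is_partition n M} \<subseteq> mset ` {xs. set xs \<subseteq> {..n} \<and> length xs \<le> n}"
  proof
    fix M assume "M \<in> {M. is_partition n M}"
    then have M: "0 \<notin># M" "sum_mset M = n"
      by (auto simp: is_partition_def)
    obtain xs where xs: "mset xs = M"
      using ex_mset by blast
    have "x \<le> n" if "x \<in># M" for x
      using M(2) sum_mset.remove[OF that] by auto
    moreover have "length xs \<le> n"
      using size_le_sum_mset[OF M(1)] M(2) xs by (metis size_mset)
    ultimately show "M \<in> mset ` {xs. set xs \<subseteq> {..n} \<and> length xs \<le> n}"
      using xs by (auto intro!: image_eqI[of _ _ xs])
  qed
  show "finite (mset ` {xs. set xs \<subseteq> {..n} \<and> length xs \<le> n})"
    by (intro finite_imageI finite_lists_length_le) simp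
qed

lemma finite_overpartitions: "finite (overpartitions n)"
proof -
  have "overpartitions n = (SIGMA M:{M. is_partition n M}. Pow (set_mset M))"
    by (auto simp: overpartitions_def)
  then show ?thesis
    using finite_is_partition by auto
qed

end

theory Submission
  imports Defs "HOL-Computational_Algebra.Formal_Power_Series"
begin

text \<open>
  Let \<open>P(q)\<close> be the generating function of overpartitions, \<open>\<phi>(q) = \<Sum>s\<in>\<int>. q\<^bsup>s\<^sup>2\<^esup>\<close>, and
  \<open>\<theta> = q d/dq\<close>. The proof rests on the formula
  \<open>\<Sum>n. some_bar n q\<^sup>n = \<theta>\<phi>(q) P(q\<^sup>2)\<^sup>2\<close> (lemma \<open>some_bar_theta\<close>), that is,
  \<open>some_bar N = \<Sum>w\<ge>1. 2 w\<^sup>2 c((N - w\<^sup>2) / 2)\<close>, where \<open>c(j)\<close> are the coefficients of \<open>P\<^sup>2\<close> and \<open>c\<close> is zero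
  outside the nonnegative integers.

  The formula comes from logarithmic derivatives. Marking a part of an overpartition shows that
  a weight \<open>f\<close> on the parts has generating function \<open>P\<close> times the Lambert series
  \<open>\<Sum>m. f m 2 q\<^sup>m / (1 - q\<^bsup>2m\<^esup>)\<close> (lemma \<open>sum_part_weights\<close>). The weight \<open>m\<close> yields \<open>\<theta>P / P\<close>, and
  the weight \<open>- (-1)\<^sup>m m\<close> yields the generating function of \<open>some_bar\<close>. Its Lambert series is
  \<open>\<theta>\<phi> / \<phi>\<close>: this is an identity of Liouville type for the solutions of \<open>n = i\<^sup>2 + d e\<close> with \<open>e\<close>
  odd, proved by sign-reversing involutions (lemma \<open>liouville_triple_sum\<close>). Comparing logarithmic
  derivatives then gives \<open>P(q) \<phi>(-q) = 1\<close> and \<open>P(q) P(-q) = P(q\<^sup>2)\<^sup>2\<close>, whence the formula.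

  For the congruences, write \<open>\<phi>(-q)\<^sup>2 = 1 + 4 S\<close>, so that \<open>P\<^sup>2 = 1 - 4 S + 16 S\<^sup>2 - \<dots>\<close>. The exponents
  in \<open>S\<close> are sums of two squares. Hence \<open>c(j)\<close> is divisible by \<open>4\<close> for \<open>j > 0\<close>, and by \<open>16\<close> if
  moreover \<open>j\<close> is not a sum of two squares. If \<open>j \<equiv> 14\<close> modulo \<open>16\<close>, the coefficient of \<open>S\<^sup>2\<close> at \<open>j\<close> is
  also divisible by \<open>4\<close>, and \<open>64\<close> divides \<open>c(j)\<close>. If \<open>N = 4\<^bsup>k-1\<^esup> M\<close> with
  \<open>M\<close> not a square and \<open>1 \<le> k \<le> 4\<close>, then every single term \<open>2 w\<^sup>2 c((N - w\<^sup>2) / 2)\<close> is divisible by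
  \<open>2\<^bsup>2k+1\<^esup>\<close>: if \<open>2\<^sup>e\<close> exactly divides \<open>w\<close> and \<open>e < k - 1\<close>, then \<open>N - w\<^sup>2\<close> is odd or \<open>(N - w\<^sup>2) / 2\<close>
  lies in a residue class where \<open>4\<^bsup>k-e\<^esup>\<close> divides \<open>c\<close>; if \<open>e = k - 1\<close>, the factor \<open>4\<close> of
  \<open>c\<close> suffices because \<open>N\<close> is not a square. Finally \<open>p n + r\<close> is not a square when \<open>r\<close> is a nonresidue modulo \<open>p\<close>.
\<close>

unbundle fps_syntax

section \<open>Weighted sums over the parts of overpartitions\<close>

lemma fps_XD_nth: "fps_XD f $ n = of_nat n * (f :: 'a :: comm_ring_1 fps) $ n"
  using fps_mult_fps_XD_shift[of 1 f] by simp

definition overpartition_fps :: "int fps" where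
  "overpartition_fps = Abs_fps (\<lambda>n. int (card (overpartitions n)))"

definition avoiding :: "nat \<Rightarrow> nat \<Rightarrow> (nat multiset \<times> nat set) set" where
  "avoiding m n = {(M, S) \<in> overpartitions n. m \<notin># M}"

definition multiplicity_fps :: "nat \<Rightarrow> int fps" where
  "multiplicity_fps m = Abs_fps (\<lambda>n. \<Sum>(M, S)\<in>overpartitions n. int (count M m))"

text \<open>The expansion of \<open>2 q\<^sup>m / (1 - q\<^bsup>2m\<^esup>)\<close>, which for \<open>m > 0\<close> is the logarithmic derivative of the
  factor \<open>(1 + x) / (1 - x)\<close>, taken as \<open>x d/dx\<close> at \<open>x = q\<^sup>m\<close>.\<close>
definition lambert_term :: "nat \<Rightarrow> int fps" where
  "lambert_term m = Abs_fps (\<lambda>n. if m dvd n \<and> odd (n div m) then 2 else 0)"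

definition lambert_fps :: "(nat \<Rightarrow> int) \<Rightarrow> int fps" where
  "lambert_fps f = Abs_fps (\<lambda>n. \<Sum>m=1..n. f m * lambert_term m $ n)"

lemma finite_avoiding: "finite (avoiding m n)"
  by (rule finite_subset[OF _ finite_overpartitions[of n]]) (auto simp: avoiding_def)

text \<open>Removing one copy of \<open>m\<close> from an overpartition \<open>(M, S)\<close> that contains \<open>m\<close> leaves an
  overpartition, except when that copy is the only one and is overlined. In this exceptional case
  the overline is removed too, and what remains has no part \<open>m\<close>. This is why two sums appear on
  the right.\<close>
lemma sum_overpartitions_containing:
  fixes g :: "nat multiset \<Rightarrow> int"
  assumes "0 < m"
  shows "(\<Sum>(M, S) | (M, S) \<in> overpartitions (m + n) \<and> m \<in># M. g M) =
    (\<Sum>(M, S)\<in>overpartitions n. g (add_mset m M)) +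
    (\<Sum>(M, S)\<in>avoiding m n. g (add_mset m M))"
proof -
  let ?h = "\<lambda>(M, S :: nat set). (add_mset m M, S)"
  let ?k = "\<lambda>(M, S). (add_mset m M, insert m S)"
  have inj: "inj_on ?h (overpartitions n)" by (auto simp: inj_on_def)
  have inj': "inj_on ?k (avoiding m n)"
    by (auto simp: inj_on_def avoiding_def overpartitions_def)
  have split: "{(M, S). (M, S) \<in> overpartitions (m + n) \<and> m \<in># M} =
    ?h ` overpartitions n \<union> ?k ` avoiding m n" (is "?A = ?B \<union> ?C")
  proof
    show "?A \<subseteq> ?B \<union> ?C"
    proof clarify
      fix M S assume *: "(M, S) \<in> overpartitions (m + n)" "m \<in># M" "(M, S) \<notin> ?C"
      from *(2) obtain M' where M: "M = add_mset m M'" by (metis insert_DiffM)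
      have S: "S \<subseteq> set_mset M'"
      proof (rule ccontr)
        assume "\<not> S \<subseteq> set_mset M'"
        then have "m \<in> S" "m \<notin># M'" using * M by (auto simp: overpartitions_def)
        then have "(M', S - {m}) \<in> avoiding m n" "(M, S) = ?k (M', S - {m})"
          using * M by (auto simp: overpartitions_def avoiding_def is_partition_def)
        then show False using *(3) by blast
      qed
      then show "(M, S) \<in> ?B"
        using * M by (intro image_eqI[of _ _ "(M', S)"])
          (auto simp: overpartitions_def is_partition_def)
    qed
    show "?B \<union> ?C \<subseteq> ?A"
      using assms by (auto simp: overpartitions_def avoiding_def is_partition_def)
  qed
  have "?B \<inter> ?C = {}" by (auto simp: overpartitions_def avoiding_def)
  then show ?thesis
    unfolding split
    by (subst sum.union_disjoint)
       (auto simp: finite_overpartitions finite_avoiding sum.reindex[OF inj]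
          sum.reindex[OF inj'] intro!: arg_cong2[where f = "(+)"] sum.cong)
qed

lemma overpartitions_small:
  assumes "n < m"
  shows "avoiding m n = overpartitions n" "(M, S) \<in> overpartitions n \<Longrightarrow> count M m = 0"
proof -
  have "m \<notin># M" if "(M, S) \<in> overpartitions n" for M S
    using that assms sum_mset.remove[of m M]
    by (auto simp: overpartitions_def is_partition_def)
  then show "avoiding m n = overpartitions n" "(M, S) \<in> overpartitions n \<Longrightarrow> count M m = 0"
    by (auto simp: avoiding_def not_in_iff)
qed

text \<open>Let \<open>x = q\<^sup>m\<close>, let \<open>P\<close> and \<open>Q\<close> count all overpartitions and those avoiding \<open>m\<close>, and let \<open>D\<close>
  count overpartitions weighted by the multiplicity of \<open>m\<close>. Removing one copy of \<open>m\<close> gives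
  \<open>P - Q = x (P + Q)\<close> and \<open>D = x (D + P + Q)\<close>; eliminating \<open>Q\<close> gives the claim.\<close>
lemma multiplicity_fps_eq:
  assumes "0 < m"
  shows "multiplicity_fps m * (1 - fps_X ^ (2 * m)) = 2 * fps_X ^ m * overpartition_fps"
proof -
  let ?P = overpartition_fps and ?D = "multiplicity_fps m" and ?x = "fps_X ^ m :: int fps"
  define Q where "Q = Abs_fps (\<lambda>n. int (card (avoiding m n)))"
  have split: "(\<Sum>(M, S)\<in>overpartitions n. g M) =
      (\<Sum>(M, S) | (M, S) \<in> overpartitions n \<and> m \<in># M. g M) + (\<Sum>(M, S)\<in>avoiding m n. g M)"
    for g :: "nat multiset \<Rightarrow> int" and n
    by (subst sum.union_disjoint[symmetric])
       (auto simp: avoiding_def finite_overpartitions intro!: sum.cong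
         intro: finite_subset[OF _ finite_overpartitions[of n]])
  have step: "(\<Sum>(M, S)\<in>overpartitions (m + n). g M) =
      (\<Sum>(M, S)\<in>overpartitions n. g (add_mset m M)) +
      (\<Sum>(M, S)\<in>avoiding m n. g (add_mset m M)) + (\<Sum>(M, S)\<in>avoiding m (m + n). g M)"
    for g :: "nat multiset \<Rightarrow> int" and n
    by (simp add: split[of g] sum_overpartitions_containing[OF assms])
  have P: "?P = Q + ?x * (?P + Q)"
  proof (rule fps_ext)
    fix n show "?P $ n = (Q + ?x * (?P + Q)) $ n"
    proof (cases "n < m")
      case True
      then show ?thesis
        by (simp add: overpartition_fps_def Q_def fps_X_power_mult_nth overpartitions_small)
    next
      case False
      then obtain k where "n = m + k" using le_Suc_ex not_less by blast
      then show ?thesis using step[of "\<lambda>_. 1" k]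
        by (simp add: overpartition_fps_def Q_def fps_X_power_mult_nth case_prod_unfold)
    qed
  qed
  have D: "?D = ?x * (?D + ?P + Q)"
  proof (rule fps_ext)
    fix n show "?D $ n = (?x * (?D + ?P + Q)) $ n"
    proof (cases "n < m")
      case True
      then show ?thesis
        by (auto simp: multiplicity_fps_def fps_X_power_mult_nth overpartitions_small
            intro!: sum.neutral)
    next
      case False
      then obtain k where n: "n = m + k" using le_Suc_ex not_less by blast
      have "(\<Sum>(M, S)\<in>avoiding m i. int (count M m)) = 0" for i
        by (rule sum.neutral) (auto simp: avoiding_def not_in_iff)
      moreover have "(\<Sum>(M, S)\<in>avoiding m k. int (count (add_mset m M) m)) = card (avoiding m k)"
      proof -
        have "(\<Sum>(M, S)\<in>avoiding m k. int (count (add_mset m M) m)) = (\<Sum>(M, S)\<in>avoiding m k. 1)"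
          by (rule sum.cong) (auto simp: avoiding_def not_in_iff)
        then show ?thesis by (simp add: case_prod_unfold)
      qed
      ultimately show ?thesis using step[of "\<lambda>M. int (count M m)" k] n
        by (simp add: overpartition_fps_def multiplicity_fps_def Q_def fps_X_power_mult_nth
            case_prod_unfold sum.distrib)
    qed
  qed
  have "?D * (1 - ?x) = ?x * (?P + Q)" using D by (simp add: algebra_simps)
  moreover have "Q * (1 + ?x) = ?P * (1 - ?x)" using P by (simp add: algebra_simps)
  moreover have "?x * (?P + Q) * (1 + ?x) = ?x * (?P * (1 + ?x) + Q * (1 + ?x))"
    by (simp add: algebra_simps)
  ultimately have "?D * (1 - ?x) * (1 + ?x) = ?x * (?P * (1 + ?x) + ?P * (1 - ?x))"
    by (simp only:)
  moreover have "(1 - ?x) * (1 + ?x) = 1 - fps_X ^ (2 * m)"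
    unfolding mult_2 power_add by (simp only: algebra_simps) simp
  moreover have "?P * (1 + ?x) + ?P * (1 - ?x) = 2 * ?P"
    unfolding mult_2 by (simp only: algebra_simps) simp
  ultimately show ?thesis by (simp only: mult.assoc mult.left_commute)
qed

lemma lambert_term_eq:
  assumes "0 < m"
  shows "lambert_term m * (1 - fps_X ^ (2 * m)) = 2 * fps_X ^ m"
proof (rule fps_ext)
  fix n
  have two: "(2 * fps_X ^ m :: int fps) $ n = (if n = m then 2 else 0)"
    by (simp add: numeral_fps_const)
  have lhs: "(lambert_term m * (1 - fps_X ^ (2 * m))) $ n =
     lambert_term m $ n - (if n < 2 * m then 0 else lambert_term m $ (n - 2 * m))"
    by (simp add: right_diff_distrib fps_X_power_mult_right_nth)
  show "(lambert_term m * (1 - fps_X ^ (2 * m))) $ n = (2 * fps_X ^ m) $ n"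
  proof (cases "n < 2 * m")
    case True
    have "m dvd n \<and> odd (n div m) \<longleftrightarrow> n = m"
    proof
      assume *: "m dvd n \<and> odd (n div m)"
      then obtain j where j: "n = m * j" by auto
      then have "odd j" "j < 2" using * assms True by auto
      then have "j = 1" by (cases j) auto
      then show "n = m" using j by simp
    qed (use assms in auto)
    then show ?thesis unfolding lhs two using True by (simp add: lambert_term_def)
  next
    case False
    then obtain k where n: "n = 2 * m + k" using le_Suc_ex not_less by blast
    have "m dvd n \<longleftrightarrow> m dvd k" by (simp add: n dvd_add_right_iff)
    moreover have "n div m = 2 + k div m" using assms by (simp add: n)
    moreover have "n \<noteq> m" using n assms by auto
    ultimately show ?thesis unfolding lhs two using n by (simp add: lambert_term_def)
  qed
qed

lemma multiplicity_fps:
  assumes "0 < m"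
  shows "multiplicity_fps m = overpartition_fps * lambert_term m"
proof -
  have "(1 - fps_X ^ (2 * m) :: int fps) $ 0 = 1" using assms by simp
  then have "(1 - fps_X ^ (2 * m) :: int fps) \<noteq> 0" by force
  moreover have "multiplicity_fps m * (1 - fps_X ^ (2 * m)) =
      overpartition_fps * lambert_term m * (1 - fps_X ^ (2 * m))"
    using multiplicity_fps_eq[OF assms] lambert_term_eq[OF assms] by (simp add: mult_ac)
  ultimately show ?thesis by (rule mult_right_cancel[THEN iffD1])
qed

lemma lambert_fps_nth:
  assumes "n \<le> N"
  shows "lambert_fps f $ n = (\<Sum>m=1..N. f m * lambert_term m $ n)"
proof -
  have "lambert_term m $ n = 0" if "n < m" for m
    using that by (cases "n = 0") (auto simp: lambert_term_def dest: dvd_imp_le)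
  then show ?thesis unfolding lambert_fps_def fps_nth_Abs_fps using assms
    by (intro sum.mono_neutral_left) auto
qed

lemma sum_mset_by_multiplicity:
  fixes f :: "nat \<Rightarrow> int"
  assumes "set_mset M \<subseteq> {1..n}"
  shows "(\<Sum>x\<in>#M. f x) = (\<Sum>m=1..n. f m * int (count M m))"
  using assms
proof (induction M)
  case (add x M)
  have "(\<Sum>m=1..n. f m * int (count (add_mset x M) m)) =
      (\<Sum>m=1..n. f m * int (count M m) + (if m = x then f m else 0))"
    by (intro sum.cong) (auto simp: algebra_simps)
  then show ?case using add by (simp add: sum.distrib)
qed simp

text \<open>The central counting principle. It is used twice: with the weight \<open>f m = m\<close>, where every
  overpartition of \<open>n\<close> has total weight \<open>n\<close>, and with the signed weight that defines
  \<open>some_bar\<close>.\<close>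
lemma sum_part_weights:
  "(\<Sum>(M, S)\<in>overpartitions n. \<Sum>x\<in>#M. f x) = (overpartition_fps * lambert_fps f) $ n"
proof -
  have "(\<Sum>x\<in>#M. f x) = (\<Sum>m=1..n. f m * int (count M m))"
    if "(M, S) \<in> overpartitions n" for M S
  proof -
    have "x \<le> n" if "x \<in># M" for x
      using \<open>(M, S) \<in> overpartitions n\<close> sum_mset.remove[OF that]
      by (auto simp: overpartitions_def is_partition_def)
    moreover have "0 \<notin># M" using that by (auto simp: overpartitions_def is_partition_def)
    ultimately have "set_mset M \<subseteq> {1..n}" by (auto simp: Suc_le_eq intro: gr0I)
    then show ?thesis by (rule sum_mset_by_multiplicity)
  qed
  then have "(\<Sum>(M, S)\<in>overpartitions n. \<Sum>x\<in>#M. f x) =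
      (\<Sum>(M, S)\<in>overpartitions n. \<Sum>m=1..n. f m * int (count M m))"
    by (intro sum.cong) auto
  also have "\<dots> = (\<Sum>m=1..n. f m * multiplicity_fps m $ n)"
    unfolding case_prod_unfold
    by (subst sum.swap) (simp add: multiplicity_fps_def sum_distrib_left case_prod_unfold)
  also have "\<dots> = (\<Sum>m=1..n. f m * (overpartition_fps * lambert_term m) $ n)"
    by (intro sum.cong) (auto simp: multiplicity_fps)
  also have "\<dots> = (\<Sum>i=0..n. \<Sum>m=1..n. overpartition_fps $ i * (f m * lambert_term m $ (n - i)))"
    by (subst sum.swap) (simp add: fps_mult_nth sum_distrib_left mult_ac)
  also have "\<dots> = (\<Sum>i=0..n. overpartition_fps $ i * lambert_fps f $ (n - i))"
    by (intro sum.cong) (auto simp: lambert_fps_nth[of _ n] sum_distrib_left)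
  finally show ?thesis by (simp add: fps_mult_nth)
qed

lemma XD_overpartition_fps: "fps_XD overpartition_fps = overpartition_fps * lambert_fps int"
proof (rule fps_ext)
  fix n
  have "(\<Sum>x\<in>#M. int x) = int n" if "(M, S) \<in> overpartitions n" for M S
    using that by (simp add: overpartitions_def is_partition_def flip: of_nat_sum_mset)
  then have "(\<Sum>(M, S)\<in>overpartitions n. \<Sum>x\<in>#M. int x) = (\<Sum>(M, S)\<in>overpartitions n. int n)"
    by (intro sum.cong) auto
  then show "fps_XD overpartition_fps $ n = (overpartition_fps * lambert_fps int) $ n"
    unfolding sum_part_weights[symmetric] fps_XD_nth
    by (simp add: overpartition_fps_def case_prod_unfold)
qed

lemma some_bar_eq:
  "some_bar n = (overpartition_fps * lambert_fps (\<lambda>m. if odd m then int m else - int m)) $ n"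
proof -
  have "odd_minus_even M = (\<Sum>x\<in>#M. if odd x then int x else - int x)" for M
    by (induction M) (auto simp: odd_minus_even_def)
  then show ?thesis by (simp add: some_bar_def sum_part_weights)
qed

section \<open>An identity of Liouville type\<close>

definition parity_sign :: "int \<Rightarrow> int" where "parity_sign i = (if even i then 1 else - 1)"

definition odd_cofactor_triples :: "int \<Rightarrow> (int \<times> int \<times> int) set" where
  "odd_cofactor_triples n = {(i, d, e). 0 < d \<and> 0 < e \<and> odd e \<and> i\<^sup>2 + d * e = n}"

lemma abs_le_square: "\<bar>i :: int\<bar> \<le> i\<^sup>2"
  using mult_left_mono[of 1 "\<bar>i\<bar>" "\<bar>i\<bar>"] by (cases "i = 0") (auto simp: power2_eq_square)

lemma quadratic_triple_bounds:
  fixes i d e n :: int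
  assumes "0 < d" "0 < e" "i\<^sup>2 + d * e = n"
  shows "i \<in> {- n..n}" "d \<in> {0..n}" "e \<in> {0..n}"
proof -
  have "d \<le> d * e" "e \<le> d * e"
    using assms mult_left_mono[of 1 e d] mult_right_mono[of 1 d e] by simp_all
  moreover have "0 \<le> i\<^sup>2" by simp
  ultimately show "i \<in> {- n..n}" "d \<in> {0..n}" "e \<in> {0..n}"
    using abs_le_square[of i] assms by (simp_all only: atLeastAtMost_iff) linarith+
qed

lemma finite_quadratic_triples:
  "finite {(i, d, e). 0 < d \<and> 0 < e \<and> i\<^sup>2 + d * e = (n :: int)}"
proof (rule finite_subset)
  show "{(i, d, e). 0 < d \<and> 0 < e \<and> i\<^sup>2 + d * e = n} \<subseteq> {- n..n} \<times> {0..n} \<times> {0..n}"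
    using quadratic_triple_bounds by blast
qed simp

lemma sum_zero_if_sign_reversing_involution:
  fixes f :: "'a \<Rightarrow> int"
  assumes "\<And>x. x \<in> A \<Longrightarrow> h x \<in> A" "\<And>x. x \<in> A \<Longrightarrow> h (h x) = x"
    and "\<And>x. x \<in> A \<Longrightarrow> f (h x) = - f x"
  shows "sum f A = 0"
proof -
  have "sum f A = (\<Sum>x\<in>A. - f x)"
    by (rule sum.reindex_bij_witness[of _ h h]) (auto simp: assms)
  then show ?thesis by (simp add: sum_negf)
qed

text \<open>A triple \<open>(i, d, e)\<close> stands for the quadratic form \<open>d x\<^sup>2 + 2 i x y - e y\<^sup>2\<close>, whose discriminant is
  \<open>4 (i\<^sup>2 + d e)\<close>. The substitution \<open>y \<mapsto> x + y\<close> followed by \<open>i \<mapsto> - i\<close> is an involution that keeps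
  \<open>d + i\<close> and \<open>e\<close> and, since \<open>e\<close> is odd, changes the parity of \<open>i\<close>. It acts on the triples with
  positive new middle entry \<open>d + 2 i - e\<close>.\<close>
lemma sum_triples_above_boundary:
  "(\<Sum>(i, d, e) | (i, d, e) \<in> odd_cofactor_triples n \<and> e < d + 2 * i. parity_sign i * (d + i)) = 0"
  by (rule sum_zero_if_sign_reversing_involution[where h = "\<lambda>(i, d, e). (e - i, d + 2 * i - e, e)"])
     (auto simp: odd_cofactor_triples_def parity_sign_def power2_eq_square algebra_simps)

text \<open>Here the form is negative at \<open>(1, 1)\<close>. In the basis \<open>(1, 0), (1, 1)\<close> it becomes the triple
  \<open>(t, d, e - d - 2 i)\<close> with \<open>t = i + d\<close>, and the weight becomes \<open>\<plusminus> t\<close>. The new triples satisfy only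
  the side condition \<open>e - d + 2 t > 0\<close>. Negating \<open>t\<close> and swapping the outer coefficients preserves
  the weight and reverses the side condition, so the sum is half of an unrestricted one, which
  vanishes under \<open>t \<mapsto> - t\<close>.\<close>
lemma sum_triples_below_boundary:
  "(\<Sum>(i, d, e) | (i, d, e) \<in> odd_cofactor_triples n \<and> d + 2 * i < e. parity_sign i * (d + i)) = 0"
    (is "?lhs = 0")
proof -
  define U where "U = {(t, d, e). 0 < d \<and> 0 < e \<and> odd (e - d) \<and> t\<^sup>2 + d * e = n}"
  define w :: "int \<times> int \<times> int \<Rightarrow> int" where "w = (\<lambda>(t, d, e). parity_sign (t + d) * t)"
  define pos neg where "pos = {(t, d, e). (t, d, e) \<in> U \<and> 0 < e - d + 2 * t}"
    and "neg = {(t, d, e). (t, d, e) \<in> U \<and> e - d + 2 * t < 0}"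
  have "?lhs = sum w pos"
    by (rule sum.reindex_bij_witness[of _ "\<lambda>(t, d, e). (t - d, d, e - d + 2 * t)"
          "\<lambda>(i, d, e). (i + d, d, e - d - 2 * i)"])
       (auto simp: pos_def U_def w_def odd_cofactor_triples_def parity_sign_def power2_eq_square
          algebra_simps)
  moreover have "sum w pos = sum w neg"
    by (rule sum.reindex_bij_witness[of _ "\<lambda>(t, d, e). (- t, e, d)" "\<lambda>(t, d, e). (- t, e, d)"])
       (auto simp: pos_def neg_def U_def w_def parity_sign_def algebra_simps split: if_splits)
  moreover have "sum w pos + sum w neg = sum w U"
  proof -
    have "finite U"
      by (rule finite_subset[OF _ finite_quadratic_triples[of n]]) (auto simp: U_def)
    moreover have "U = pos \<union> neg"
    proof -
      have "0 < e - d + 2 * t \<or> e - d + 2 * t < 0" if "odd (e - d)" for t d e :: int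
        using that by presburger
      then show ?thesis unfolding pos_def neg_def U_def by blast
    qed
    moreover have "pos \<inter> neg = {}" by (auto simp: pos_def neg_def)
    ultimately show ?thesis by (simp add: sum.union_disjoint)
  qed
  moreover have "sum w U = 0"
    by (rule sum_zero_if_sign_reversing_involution[where h = "\<lambda>(t, d, e). (- t, d, e)"])
       (auto simp: U_def w_def parity_sign_def)
  ultimately show ?thesis by simp
qed

text \<open>On the boundary \<open>e = d + 2 i\<close> one has \<open>n = (d + i)\<^sup>2\<close>. If \<open>n = w\<^sup>2\<close> with \<open>w > 0\<close>, the boundary
  consists of \<open>w\<close> triples, one for each odd \<open>e\<close> between \<open>0\<close> and \<open>2 w\<close>, and each has weight \<open>\<plusminus> w\<close>.\<close>
lemma sum_triples_on_boundary:
  assumes "0 < n"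
  shows "(\<Sum>(i, d, e) | (i, d, e) \<in> odd_cofactor_triples n \<and> e = d + 2 * i. parity_sign i * (d + i)) =
    (if \<exists>w. n = w\<^sup>2 then - parity_sign n * n else 0)" (is "sum ?f ?A = _")
proof (cases "\<exists>w. n = w\<^sup>2")
  case False
  have "n = (d + i)\<^sup>2" if "n = i\<^sup>2 + d * (d + 2 * i)" for i d
    using that by (simp add: power2_eq_square algebra_simps)
  then have "?A = {}" using False by (auto simp: odd_cofactor_triples_def)
  then have "sum ?f ?A = 0" by (simp only: sum.empty)
  then show ?thesis using False by simp
next
  case True
  then obtain v where "n = v\<^sup>2" by auto
  then have w: "n = \<bar>v\<bar>\<^sup>2" by simp
  define w where "w = \<bar>v\<bar>"
  have w: "n = w\<^sup>2" "0 < w" using w assms by (auto simp: w_def)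
  have boundary: "\<exists>i. a = (i, w - i, w + i) \<and> odd (w + i) \<and> 0 < w - i \<and> 0 < w + i"
    if mem: "a \<in> ?A" for a
  proof -
    obtain i d e where a: "a = (i, d, e)" "0 < d" "0 < e" "odd e" "e = d + 2 * i"
      "i\<^sup>2 + d * e = n"
      using mem by (auto simp: odd_cofactor_triples_def)
    then have "(d + i)\<^sup>2 = w\<^sup>2" "0 < d + i" using w by (simp_all add: power2_eq_square algebra_simps)
    then have "d + i = w" using w(2) by (intro power2_eq_imp_eq[of "d + i" w]) simp_all
    then have "d = w - i" by simp
    then show ?thesis using a by auto
  qed
  \<comment> \<open>The index \<open>j\<close> stands for \<open>e = 2 j + 1\<close>; then \<open>i = e - w\<close> and \<open>d = 2 w - e\<close>.\<close>
  have "sum ?f ?A = (\<Sum>j\<in>{0..<w}. - parity_sign w * w)"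
  proof (rule sum.reindex_bij_witness[of _ "\<lambda>j. (2 * j + 1 - w, 2 * w - 1 - 2 * j, 2 * j + 1)"
        "\<lambda>(i, d, e). (e - 1) div 2"], goal_cases)
    case (1 a)
    then show ?case using boundary[of a] by auto
  next
    case (2 a)
    then show ?case using boundary[of a] by auto
  next
    case (3 j) then show ?case by simp
  next
    case (4 j)
    then show ?case using w by (auto simp: odd_cofactor_triples_def power2_eq_square algebra_simps)
  next
    case (5 a)
    then show ?case using boundary[of a] by (auto simp: parity_sign_def)
  qed
  also have "\<dots> = - parity_sign n * n" using w by (simp add: parity_sign_def power2_eq_square)
  finally show ?thesis using True by simp
qed

text \<open>Modulo \<open>2\<close> one has \<open>d \<equiv> n + i\<close>, and \<open>i \<mapsto> - i\<close> kills the sum of \<open>\<plusminus> i\<close>, so up to a global sign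
  the weight \<open>\<plusminus> d\<close> may be replaced by \<open>\<plusminus> (d + i)\<close>, the sign now being that of the parity of \<open>i\<close>.
  Only the boundary contributes to the new sum.\<close>
lemma liouville_triple_sum:
  assumes "0 < n"
  shows "(\<Sum>(i, d, e)\<in>odd_cofactor_triples n. - parity_sign d * d) = (if \<exists>w. n = w\<^sup>2 then n else 0)"
proof -
  let ?T = "odd_cofactor_triples n"
  let ?f = "\<lambda>(i, d, e). parity_sign i * (d + i)"
  have fin: "finite ?T"
    by (rule finite_subset[OF _ finite_quadratic_triples[of n]])
       (auto simp: odd_cofactor_triples_def)
  have sub: "finite {(i, d, e). (i, d, e) \<in> ?T \<and> R i d e}" for R
    by (rule finite_subset[OF _ fin]) auto
  have "?T = {(i, d, e). (i, d, e) \<in> ?T \<and> e < d + 2 * i} \<union>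
      ({(i, d, e). (i, d, e) \<in> ?T \<and> d + 2 * i < e} \<union>
       {(i, d, e). (i, d, e) \<in> ?T \<and> e = d + 2 * i})" (is "_ = ?A \<union> (?B \<union> ?C)")
    by auto
  then have "sum ?f ?T = sum ?f (?A \<union> (?B \<union> ?C))" by simp
  also have "\<dots> = sum ?f ?A + (sum ?f ?B + sum ?f ?C)"
    using sub by (subst sum.union_disjoint; force?) (subst sum.union_disjoint; force?)
  finally have "sum ?f ?T = (if \<exists>w. n = w\<^sup>2 then - parity_sign n * n else 0)"
    using sum_triples_above_boundary[of n] sum_triples_below_boundary[of n]
      sum_triples_on_boundary[OF assms]
    by simp
  moreover have "(\<Sum>(i, d, e)\<in>?T. parity_sign i * i) = 0"
    by (rule sum_zero_if_sign_reversing_involution[where h = "\<lambda>(i, d, e). (- i, d, e)"])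
       (auto simp: odd_cofactor_triples_def parity_sign_def)
  moreover have "sum ?f ?T = (\<Sum>(i, d, e)\<in>?T. parity_sign i * d) + (\<Sum>(i, d, e)\<in>?T. parity_sign i * i)"
    by (simp add: sum.distrib[symmetric] case_prod_unfold algebra_simps)
  moreover have "(\<Sum>(i, d, e)\<in>?T. - parity_sign d * d) =
      - parity_sign n * (\<Sum>(i, d, e)\<in>?T. parity_sign i * d)"
    unfolding sum_distrib_left
    by (rule sum.cong) (auto simp: odd_cofactor_triples_def parity_sign_def)
  moreover have "parity_sign n * parity_sign n = 1" by (simp add: parity_sign_def)
  ultimately show ?thesis by auto
qed

section \<open>The theta function and the generating function of overpartitions\<close>

text \<open>The theta function \<open>\<phi>(q) = \<Sum>s\<in>\<int>. q\<^bsup>s\<^sup>2\<^esup>\<close>.\<close>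
definition theta_fps :: "int fps" where
  "theta_fps = Abs_fps (\<lambda>n. int (card {s :: int. s\<^sup>2 = int n}))"

lemma finite_square_roots: "finite {s :: int. s\<^sup>2 = int n}"
proof (rule finite_subset)
  have "s \<in> {- int n..int n}" if "s\<^sup>2 = int n" for s
    using that abs_le_square by (metis abs_le_D1 abs_le_D2 atLeastAtMost_iff minus_le_iff)
  then show "{s :: int. s\<^sup>2 = int n} \<subseteq> {- int n..int n}" by blast
qed simp

lemma theta_fps_nth:
  "theta_fps $ n = (if n = 0 then 1 else if \<exists>w. n = w\<^sup>2 then 2 else 0)"
proof (cases "\<exists>w. n = w\<^sup>2")
  case True
  then obtain w where w: "n = w\<^sup>2" by auto
  then have "{s :: int. s\<^sup>2 = int n} = {int w, - int w}" by (auto simp: power2_eq_iff)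
  then show ?thesis using w by (cases "w = 0") (auto simp: theta_fps_def)
next
  case False
  have "s\<^sup>2 \<noteq> int n" for s :: int
  proof
    assume "s\<^sup>2 = int n"
    then have "n = (nat \<bar>s\<bar>)\<^sup>2" by (metis nat_int nat_power_eq abs_ge_zero power2_abs)
    then show False using False by auto
  qed
  then have "{s :: int. s\<^sup>2 = int n} = {}" by auto
  moreover have "n \<noteq> 0" using False by (metis zero_power2)
  ultimately show ?thesis using False by (simp add: theta_fps_def)
qed

abbreviation alternating_id :: "nat \<Rightarrow> int" where
  "alternating_id m \<equiv> (if odd m then int m else - int m)"

text \<open>The coefficient of \<open>q\<^sup>n\<close> on the right is twice a sum over \<open>n = s\<^sup>2 + m e\<close> with \<open>e\<close> odd and \<open>m\<close>
  weighted by \<open>\<plusminus> m\<close>, that is, over the triples of the Liouville-type identity.\<close>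
lemma XD_theta_fps: "fps_XD theta_fps = theta_fps * lambert_fps alternating_id"
proof (rule fps_ext)
  fix n
  define D where "D k = {m \<in> {1..k}. m dvd k \<and> odd (k div m)}" for k :: nat
  have finD: "finite (D k)" for k by (simp add: D_def)
  have lam: "lambert_fps alternating_id $ k = 2 * (\<Sum>m\<in>D k. alternating_id m)" for k
  proof -
    have "lambert_fps alternating_id $ k =
        (\<Sum>m=1..k. if m dvd k \<and> odd (k div m) then 2 * alternating_id m else 0)"
      by (auto simp: lambert_fps_def lambert_term_def intro!: sum.cong)
    also have "\<dots> = (\<Sum>m\<in>D k. 2 * alternating_id m)"
      unfolding D_def by (rule sum.inter_filter[symmetric]) simp
    finally show ?thesis by (simp add: sum_distrib_left)
  qed
  show "fps_XD theta_fps $ n = (theta_fps * lambert_fps alternating_id) $ n"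
  proof (cases "n = 0")
    case True
    then show ?thesis by (simp add: fps_XD_nth lam D_def)
  next
    case False
    have "(theta_fps * lambert_fps alternating_id) $ n =
        2 * (\<Sum>k\<in>{0..n}. \<Sum>s\<in>{s :: int. s\<^sup>2 = int k}. \<Sum>m\<in>D (n - k). alternating_id m)"
      unfolding fps_mult_nth lam theta_fps_def fps_nth_Abs_fps sum_distrib_left
      by (intro sum.cong) (auto simp: sum_distrib_left)
    also have "(\<Sum>k\<in>{0..n}. \<Sum>s\<in>{s :: int. s\<^sup>2 = int k}. \<Sum>m\<in>D (n - k). alternating_id m) =
        (\<Sum>(k, s, m)\<in>(SIGMA k:{0..n}. {s :: int. s\<^sup>2 = int k} \<times> D (n - k)). alternating_id m)"
      unfolding sum.cartesian_product
      by (subst sum.Sigma) (auto simp: finite_square_roots finD case_prod_unfold)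
    also have "\<dots> = (\<Sum>(i, d, e)\<in>odd_cofactor_triples (int n). - parity_sign d * d)"
    proof (rule sum.reindex_bij_witness[of _ "\<lambda>(i, d, e). (nat (i\<^sup>2), i, nat d)"
          "\<lambda>(k, s, m). (s, int m, int ((n - k) div m))"], goal_cases)
      case (1 a)
      then show ?case by auto
    next
      case (2 a)
      then obtain k s m where a: "a = (k, s, m)" "k \<le> n" "s\<^sup>2 = int k" "m \<in> D (n - k)"
        by auto
      then have "0 < m" "m dvd n - k" "odd ((n - k) div m)" by (auto simp: D_def)
      moreover from this have "m * ((n - k) div m) = n - k" by simp
      then have "s\<^sup>2 + int m * int ((n - k) div m) = int n"
        using a(2,3) by (simp flip: of_nat_mult)
      ultimately show ?case using a(1)
        by (auto simp: odd_cofactor_triples_def intro!: Nat.gr0I)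
    next
      case (3 b)
      then obtain i d e where b: "b = (i, d, e)" "0 < d" "0 < e" "odd e" "i\<^sup>2 + d * e = int n"
        by (auto simp: odd_cofactor_triples_def)
      then have "0 < d * e" by simp
      then have "nat (i\<^sup>2) \<le> n" using b unfolding nat_le_iff by linarith
      then have "int (n - nat (i\<^sup>2)) = d * e" using b by (simp add: of_nat_diff)
      then have "n - nat (i\<^sup>2) = nat d * nat e"
        using b by (metis nat_int nat_mult_distrib less_imp_le)
      then show ?case using b by simp
    next
      case (4 b)
      then obtain i d e where b: "b = (i, d, e)" "0 < d" "0 < e" "odd e" "i\<^sup>2 + d * e = int n"
        by (auto simp: odd_cofactor_triples_def)
      have de: "0 < d * e" using b by simp
      then have le: "nat (i\<^sup>2) \<le> n" using b unfolding nat_le_iff by linarith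
      then have "int (n - nat (i\<^sup>2)) = d * e" using b by (simp add: of_nat_diff)
      then have eq: "n - nat (i\<^sup>2) = nat d * nat e"
        using b by (metis nat_int nat_mult_distrib less_imp_le)
      have "nat d \<in> D (n - nat (i\<^sup>2))"
        unfolding D_def eq using b by (auto simp: even_nat_iff)
      then show ?case using b le by auto
    next
      case (5 a)
      then show ?case by (auto simp: parity_sign_def)
    qed
    also have "\<dots> = (if \<exists>w. int n = w\<^sup>2 then int n else 0)"
      using False by (intro liouville_triple_sum) simp
    also have "(\<exists>w. int n = w\<^sup>2) \<longleftrightarrow> (\<exists>w. n = w\<^sup>2)"
      by (metis nat_int nat_power_eq abs_ge_zero power2_abs of_nat_power)
    finally show ?thesis using False by (simp add: fps_XD_nth theta_fps_nth)
  qed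
qed

abbreviation negate_arg :: "int fps \<Rightarrow> int fps" where "negate_arg f \<equiv> f oo (- fps_X)"
abbreviation square_arg :: "int fps \<Rightarrow> int fps" where "square_arg f \<equiv> f oo (fps_X ^ 2)"

lemma negate_arg_nth: "negate_arg f $ n = (- 1) ^ n * f $ n"
  by (simp add: fps_compose_uminus')

lemma square_arg_nth: "square_arg f $ n = (if even n then f $ (n div 2) else 0)"
proof -
  have "square_arg f $ n = (\<Sum>i=0..n. if n = 2 * i then f $ i else 0)"
    by (simp add: fps_compose_nth flip: power_mult) (rule sum.cong; simp)
  also have "\<dots> = (\<Sum>i\<in>{0..n}. if i = n div 2 then if even n then f $ i else 0 else 0)"
    by (intro sum.cong) auto
  finally show ?thesis by simp
qed

lemma fps_XD_mult: "fps_XD (f * g) = fps_XD f * g + f * fps_XD (g :: 'a :: comm_ring_1 fps)"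
  by (simp add: fps_XD_def algebra_simps)

lemma XD_negate_arg: "fps_XD (negate_arg f) = negate_arg (fps_XD f)"
  by (rule fps_ext) (simp add: fps_XD_nth negate_arg_nth)

lemma XD_square_arg: "fps_XD (square_arg f) = 2 * square_arg (fps_XD f)"
  by (rule fps_ext) (auto simp: fps_XD_nth square_arg_nth numeral_fps_const)

lemma eq_one_if_XD_zero:
  assumes "fps_XD f = 0" "f $ 0 = (1 :: int)"
  shows "f = 1"
proof (rule fps_ext)
  fix n
  have "int n * f $ n = 0" using assms(1) fps_XD_nth[of f n] by simp
  then show "f $ n = 1 $ n" using assms(2) by (cases "n = 0") auto
qed

lemma negate_arg_lambert: "negate_arg (lambert_fps alternating_id) = - lambert_fps int"
proof (rule fps_ext)
  fix n
  have "(- 1) ^ n * (alternating_id m * lambert_term m $ n) = - (int m * lambert_term m $ n)" for m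
  proof (cases "m dvd n \<and> odd (n div m)")
    case True
    then have "even n \<longleftrightarrow> even m" by (metis dvd_div_mult_self even_mult_iff)
    then show ?thesis by (auto simp: lambert_term_def)
  qed (auto simp: lambert_term_def)
  then show "negate_arg (lambert_fps alternating_id) $ n = (- lambert_fps int) $ n"
    by (simp add: negate_arg_nth lambert_fps_def sum_distrib_left sum_negf)
qed

lemma overpartition_fps_0: "overpartition_fps $ 0 = 1"
proof -
  have "overpartitions 0 = {({#}, {})}"
    by (auto simp: overpartitions_def is_partition_def)
       (metis gr0I multiset_nonemptyE)+
  then show ?thesis by (simp add: overpartition_fps_def)
qed

text \<open>This is the identity of Gauss \<open>\<phi>(-q) = \<Prod>(1 - q\<^sup>m) / (1 + q\<^sup>m)\<close>, read with \<open>P\<close> as the reciprocal of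
  the product. The logarithmic derivatives of the two factors cancel.\<close>
lemma overpartition_fps_mult_theta: "overpartition_fps * negate_arg theta_fps = 1"
proof (rule eq_one_if_XD_zero)
  show "fps_XD (overpartition_fps * negate_arg theta_fps) = 0"
    by (simp add: fps_XD_mult XD_negate_arg XD_theta_fps XD_overpartition_fps
        fps_compose_mult_distrib negate_arg_lambert)
qed (simp add: overpartition_fps_0 theta_fps_nth)

text \<open>The two weights differ only at even \<open>m\<close>, where the difference is \<open>2 m\<close>; the terms with \<open>m = 2 m'\<close>
  reproduce the series at \<open>q\<^sup>2\<close>.\<close>
lemma lambert_fps_diff:
  "lambert_fps int - lambert_fps alternating_id = 4 * square_arg (lambert_fps int)"
proof (rule fps_ext)
  fix n
  have "lambert_fps int $ n - lambert_fps alternating_id $ n =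
      (\<Sum>m=1..n. if even m then 2 * int m * lambert_term m $ n else 0)"
    by (auto simp: lambert_fps_def sum_subtractf[symmetric] intro!: sum.cong)
  also have "\<dots> = (\<Sum>m | m \<in> {1..n} \<and> even m. 2 * int m * lambert_term m $ n)"
    by (rule sum.inter_filter[symmetric]) simp
  also have "\<dots> = (\<Sum>m=1..n div 2. 4 * (int m * lambert_term (2 * m) $ n))"
    by (rule sum.reindex_bij_witness[of _ "\<lambda>m. 2 * m" "\<lambda>m. m div 2"]) auto
  also have "\<dots> = (if even n then 4 * (\<Sum>m=1..n div 2. int m * lambert_term m $ (n div 2)) else 0)"
  proof (cases "even n")
    case True
    then obtain k where "n = 2 * k" by auto
    then have "lambert_term (2 * m) $ n = lambert_term m $ (n div 2)" for m
      by (simp add: lambert_term_def)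
    then show ?thesis using True by (simp add: sum_distrib_left)
  next
    case False
    then have "lambert_term (2 * m) $ n = 0" for m
      by (auto simp: lambert_term_def)
    then show ?thesis using False by simp
  qed
  finally show "(lambert_fps int - lambert_fps alternating_id) $ n =
      (4 * square_arg (lambert_fps int)) $ n"
    by (simp add: square_arg_nth numeral_fps_const) (simp add: lambert_fps_def)
qed

lemma negate_overpartition_fps_mult_theta: "negate_arg overpartition_fps * theta_fps = 1"
proof -
  have "negate_arg (overpartition_fps * negate_arg theta_fps) = 1"
    by (simp add: overpartition_fps_mult_theta)
  moreover have "negate_arg (negate_arg theta_fps) = theta_fps"
    by (rule fps_ext) (simp add: negate_arg_nth flip: power_add mult.assoc)
  ultimately show ?thesis by (simp add: fps_compose_mult_distrib)
qed

text \<open>Equivalent to \<open>\<phi>(q) \<phi>(-q) = \<phi>(-q\<^sup>2)\<^sup>2\<close>. By \<open>lambert_fps_diff\<close> the logarithmic derivative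
  of \<open>\<phi>(q) \<phi>(-q) P(q\<^sup>2)\<^sup>2\<close> is zero, so this product is \<open>1\<close>; the reciprocals of its first two
  factors are \<open>P(-q)\<close> and \<open>P(q)\<close>.\<close>
lemma overpartition_product:
  "overpartition_fps * negate_arg overpartition_fps = square_arg (overpartition_fps\<^sup>2)"
proof -
  let ?P = overpartition_fps and ?t = "theta_fps" and ?B = "lambert_fps int"
    and ?A = "lambert_fps alternating_id"
  let ?T = "?t * negate_arg ?t" and ?S = "square_arg ?P"
  have "fps_XD (?T * (?S * ?S)) = 0"
  proof -
    have XT: "fps_XD ?T = ?T * (?A - ?B)"
      by (simp add: fps_XD_mult XD_negate_arg XD_theta_fps fps_compose_mult_distrib
          negate_arg_lambert algebra_simps)
    have XS: "fps_XD ?S = 2 * (?S * square_arg ?B)"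
      by (simp add: XD_square_arg XD_overpartition_fps fps_compose_mult_distrib)
    have "fps_XD (?T * (?S * ?S)) = ?T * (?S * ?S) * (4 * square_arg ?B - (?B - ?A))"
      unfolding fps_XD_mult[of ?T] fps_XD_mult[of ?S] XT XS by (simp add: algebra_simps)
    then show ?thesis by (simp add: lambert_fps_diff)
  qed
  then have "?T * (?S * ?S) = 1"
    by (rule eq_one_if_XD_zero) (simp add: overpartition_fps_0 theta_fps_nth)
  then have "?P * negate_arg ?P = ?P * negate_arg ?P * (?T * (?S * ?S))" by simp
  also have "\<dots> = (?P * negate_arg ?t) * (negate_arg ?P * ?t) * (?S * ?S)"
    by (simp only: mult_ac)
  finally show ?thesis
    by (simp add: negate_overpartition_fps_mult_theta overpartition_fps_mult_theta
        power2_eq_square fps_compose_mult_distrib)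
qed

text \<open>By the counting principle the generating function of \<open>some_bar\<close> is \<open>P\<close> times the logarithmic
  derivative of \<open>\<phi>\<close>; and \<open>P(q) / \<phi>(q) = P(q) P(-q)\<close>.\<close>
lemma some_bar_theta:
  "some_bar n = (fps_XD theta_fps * square_arg (overpartition_fps\<^sup>2)) $ n"
proof -
  let ?P = overpartition_fps and ?A = "lambert_fps alternating_id"
  have "?P * ?A = ?P * ?A * (negate_arg ?P * theta_fps)"
    by (simp add: negate_overpartition_fps_mult_theta)
  also have "\<dots> = fps_XD theta_fps * square_arg (?P\<^sup>2)"
    by (simp add: XD_theta_fps mult_ac flip: overpartition_product)
  finally show ?thesis by (simp add: some_bar_eq)
qed

section \<open>Congruences for the square of the overpartition series\<close>

text \<open>The Frobenius congruence \<open>f(q)\<^sup>2 \<equiv> f(q\<^sup>2)\<close> modulo \<open>2\<close>: in the Cauchy square the terms \<open>(i, n - i)\<close>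
  and \<open>(n - i, i)\<close> are equal, and \<open>x\<^sup>2 \<equiv> x\<close> for the middle term.\<close>
lemma fps_square_mod_2: "\<exists>E. f\<^sup>2 = square_arg f + 2 * E"
proof -
  have "2 dvd (f\<^sup>2) $ n - square_arg f $ n" for n
  proof -
    let ?h = "\<lambda>i. f $ i * f $ (n - i)"
    have "(f\<^sup>2) $ n = sum ?h ({i. 2 * i < n} \<union> ({i \<in> {0..n}. n < 2 * i} \<union> {i. 2 * i = n}))"
      unfolding power2_eq_square fps_mult_nth by (rule sum.cong) auto
    also have "\<dots> = sum ?h {i. 2 * i < n} + (sum ?h {i \<in> {0..n}. n < 2 * i} + sum ?h {i. 2 * i = n})"
    proof -
      have "finite {i. 2 * i < n}" "finite {i. 2 * i = n}"
        by (auto intro: finite_subset[of _ "{0..n}"])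
      then show ?thesis
        by (subst sum.union_disjoint; auto?) (subst sum.union_disjoint; auto)
    qed
    also have "sum ?h {i \<in> {0..n}. n < 2 * i} = sum ?h {i. 2 * i < n}"
      by (rule sum.reindex_bij_witness[of _ "\<lambda>i. n - i" "\<lambda>i. n - i"]) auto
    also have "sum ?h {i. 2 * i = n} = (if even n then (f $ (n div 2))\<^sup>2 else 0)"
    proof (cases "even n")
      case True
      then have "{i. 2 * i = n} = {n div 2}" "n - n div 2 = n div 2" by auto
      then show ?thesis using True by (simp add: power2_eq_square)
    next
      case False
      then have "{i. 2 * i = n} = {}" by auto
      then show ?thesis using False by simp
    qed
    finally have "(f\<^sup>2) $ n - square_arg f $ n =
        2 * sum ?h {i. 2 * i < n} + (if even n then (f $ (n div 2))\<^sup>2 - f $ (n div 2) else 0)"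
      by (simp add: square_arg_nth)
    then show ?thesis by (simp add: even_diff_iff)
  qed
  then have "f\<^sup>2 = square_arg f + 2 * Abs_fps (\<lambda>n. ((f\<^sup>2) $ n - square_arg f $ n) div 2)"
    by (intro fps_ext) (simp add: numeral_fps_const)
  then show ?thesis by blast
qed

definition squares_fps :: "int fps" where
  "squares_fps = Abs_fps (\<lambda>n. if 0 < n \<and> (\<exists>a. n = a\<^sup>2) then (- 1) ^ n else 0)"

lemma negate_theta_fps: "negate_arg theta_fps = 1 + 2 * squares_fps"
  by (rule fps_ext) (auto simp: negate_arg_nth theta_fps_nth squares_fps_def numeral_fps_const)

lemma squares_fps_support: "squares_fps $ n \<noteq> 0 \<Longrightarrow> \<exists>a. n = a\<^sup>2"
  by (auto simp: squares_fps_def split: if_splits)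

lemma square_squares_fps_support: "square_arg squares_fps $ n \<noteq> 0 \<Longrightarrow> \<exists>a. n = 2 * a\<^sup>2"
  using squares_fps_support[of "n div 2"] by (auto simp: square_arg_nth split: if_splits)

lemma fps_mult_support:
  assumes "(f * g :: int fps) $ n \<noteq> 0"
  obtains i j where "n = i + j" "f $ i \<noteq> 0" "g $ j \<noteq> 0"
proof -
  obtain i where "i \<in> {0..n}" "f $ i * g $ (n - i) \<noteq> 0"
    using assms unfolding fps_mult_nth by (meson sum.neutral)
  then show ?thesis using that[of i "n - i"] by auto
qed

text \<open>The series \<open>S\<close> with \<open>\<phi>(-q)\<^sup>2 = (1 + 2 F)\<^sup>2 = 1 + 4 S\<close>, where \<open>F\<close> is \<open>squares_fps\<close>.\<close>
definition theta_square_tail :: "int fps" where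
  "theta_square_tail = squares_fps + squares_fps\<^sup>2"

lemma theta_square_tail_support:
  assumes "\<And>a b. n \<noteq> a\<^sup>2 + b\<^sup>2"
  shows "theta_square_tail $ n = 0"
proof -
  have "squares_fps $ n = 0" using squares_fps_support[of n] assms[of _ 0] by auto
  moreover have "(squares_fps\<^sup>2) $ n = 0"
    using fps_mult_support[of squares_fps squares_fps n] squares_fps_support assms
    unfolding power2_eq_square[of squares_fps] by metis
  ultimately show ?thesis by (simp add: theta_square_tail_def)
qed

text \<open>Since \<open>P \<phi>(-q) = 1\<close> and \<open>\<phi>(-q)\<^sup>2 = 1 + 4 S\<close>, the series \<open>P\<^sup>2\<close> is the geometric series in
  \<open>- 4 S\<close>. These are its finite forms with remainder.\<close>
lemma overpartition_square_expand:
  "overpartition_fps\<^sup>2 = 1 - 4 * (theta_square_tail * overpartition_fps\<^sup>2)" (is ?one)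
  "overpartition_fps\<^sup>2 = 1 - 4 * theta_square_tail + 16 * (theta_square_tail\<^sup>2 * overpartition_fps\<^sup>2)"
    (is ?two)
  "overpartition_fps\<^sup>2 = 1 - 4 * theta_square_tail + 16 * theta_square_tail\<^sup>2
     - 64 * (theta_square_tail ^ 3 * overpartition_fps\<^sup>2)" (is ?three)
proof -
  let ?C = "overpartition_fps\<^sup>2" and ?S = theta_square_tail
  have "(overpartition_fps * negate_arg theta_fps)\<^sup>2 = 1"
    by (simp add: overpartition_fps_mult_theta)
  then have "?C * (1 + 4 * ?S) = 1"
    by (simp add: negate_theta_fps theta_square_tail_def power2_eq_square algebra_simps)
  then show 1: ?one by (simp add: algebra_simps)
  then have "?C = 1 - 4 * (?S * (1 - 4 * (?S * ?C)))" by simp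
  then show 2: ?two by (simp add: algebra_simps power2_eq_square)
  have "?C = 1 - 4 * ?S + 16 * (?S\<^sup>2 * (1 - 4 * (?S * ?C)))" using 1 2 by simp
  then show ?three by (simp add: algebra_simps power2_eq_square power3_eq_cube)
qed

lemma overpartition_square_mod_4:
  assumes "0 < n"
  shows "4 dvd (overpartition_fps\<^sup>2) $ n"
  by (subst overpartition_square_expand(1)) (use assms in \<open>simp add: numeral_fps_const\<close>)

lemma overpartition_square_mod_16:
  assumes "0 < n" "\<And>a b. n \<noteq> a\<^sup>2 + b\<^sup>2"
  shows "16 dvd (overpartition_fps\<^sup>2) $ n"
  by (subst overpartition_square_expand(2))
     (use assms theta_square_tail_support in \<open>simp add: numeral_fps_const\<close>)

lemma square_mod_32: "(a :: nat)\<^sup>2 mod 32 \<in> {0, 1, 4, 9, 16, 17, 25}"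
proof -
  have "\<forall>r\<in>{..<32}. r\<^sup>2 mod 32 \<in> {0, 1, 4, 9, 16, 17, 25 :: nat}"
    by (simp add: lessThan_nat_numeral lessThan_Suc)
  then have "(a mod 32)\<^sup>2 mod 32 \<in> {0, 1, 4, 9, 16, 17, 25}" by simp
  then show ?thesis by (simp add: power_mod)
qed

lemma not_binary_square_form:
  fixes n a b :: nat
  shows "n mod 8 = 6 \<Longrightarrow> n \<noteq> a\<^sup>2 + b\<^sup>2" and "n mod 32 = 24 \<Longrightarrow> n \<noteq> a\<^sup>2 + b\<^sup>2"
    and "n mod 16 = 14 \<Longrightarrow> n \<noteq> a\<^sup>2 + 2 * b\<^sup>2"
    and "n mod 16 = 14 \<Longrightarrow> n \<noteq> 2 * a\<^sup>2 + 2 * b\<^sup>2"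
proof -
  have sq: "a\<^sup>2 mod 8 \<in> {0, 1, 4}" "a\<^sup>2 mod 16 \<in> {0, 1, 4, 9}" for a :: nat
  proof -
    have "a\<^sup>2 mod 8 = a\<^sup>2 mod 32 mod 8" "a\<^sup>2 mod 16 = a\<^sup>2 mod 32 mod 16"
      by (simp_all add: mod_mod_cancel)
    then show "a\<^sup>2 mod 8 \<in> {0, 1, 4}" "a\<^sup>2 mod 16 \<in> {0, 1, 4, 9}"
      using square_mod_32[of a] by auto
  qed
  have mods: "(a\<^sup>2 + b\<^sup>2) mod 8 = (a\<^sup>2 mod 8 + b\<^sup>2 mod 8) mod 8"
    "(a\<^sup>2 + b\<^sup>2) mod 32 = (a\<^sup>2 mod 32 + b\<^sup>2 mod 32) mod 32"
    "(a\<^sup>2 + 2 * b\<^sup>2) mod 16 = (a\<^sup>2 mod 16 + 2 * (b\<^sup>2 mod 16)) mod 16"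
    "(2 * a\<^sup>2 + 2 * b\<^sup>2) mod 16 = (2 * (a\<^sup>2 mod 16) + 2 * (b\<^sup>2 mod 16)) mod 16"
    by (simp_all only: mod_simps) (intro mod_add_cong mod_mult_cong; simp)+
  show "n \<noteq> a\<^sup>2 + b\<^sup>2" if "n mod 8 = 6"
    using that sq(1)[of a] sq(1)[of b] mods(1) by auto
  show "n \<noteq> a\<^sup>2 + b\<^sup>2" if "n mod 32 = 24"
    using that square_mod_32[of a] square_mod_32[of b] mods(2) by auto
  show "n \<noteq> a\<^sup>2 + 2 * b\<^sup>2" if "n mod 16 = 14"
    using that sq(2)[of a] sq(2)[of b] mods(3) by auto
  show "n \<noteq> 2 * a\<^sup>2 + 2 * b\<^sup>2" if "n mod 16 = 14"
    using that sq(2)[of a] sq(2)[of b] mods(4) by auto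
qed

text \<open>If \<open>n \<equiv> 14\<close> modulo \<open>16\<close>, the coefficient of \<open>S\<close> at \<open>n\<close> is zero, so \<open>16 S\<^sup>2\<close> decides. By the
  Frobenius congruence \<open>S = F(q) + F(q\<^sup>2) + 2 E\<close>, hence \<open>S\<^sup>2 \<equiv> F(q)\<^sup>2 + F(q\<^sup>2)\<^sup>2 + 2 F(q) F(q\<^sup>2)\<close>
  modulo \<open>4\<close>. The exponents of these three products are values of \<open>a\<^sup>2 + b\<^sup>2\<close>, \<open>2 a\<^sup>2 + 2 b\<^sup>2\<close> and
  \<open>a\<^sup>2 + 2 b\<^sup>2\<close>, none of which represents \<open>n\<close>.\<close>
lemma overpartition_square_mod_64:
  assumes n: "n mod 16 = 14"
  shows "64 dvd (overpartition_fps\<^sup>2) $ n"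
proof -
  let ?F = squares_fps and ?S = theta_square_tail
  let ?G = "square_arg ?F"
  obtain E where E: "?F\<^sup>2 = ?G + 2 * E" using fps_square_mod_2 by blast
  have "n mod 8 = 6" using n by presburger
  then have S: "?S $ n = 0" by (intro theta_square_tail_support not_binary_square_form(1))
  have FF: "(?F * ?F) $ n = 0"
    using fps_mult_support[of ?F ?F n] squares_fps_support
      not_binary_square_form(1)[OF \<open>n mod 8 = 6\<close>] by metis
  have FG: "(?F * ?G) $ n = 0"
    using fps_mult_support[of ?F ?G n] squares_fps_support square_squares_fps_support
      not_binary_square_form(3)[OF n] by metis
  have GG: "(?G * ?G) $ n = 0"
    using fps_mult_support[of ?G ?G n] square_squares_fps_support
      not_binary_square_form(4)[OF n] by metis
  have "?S\<^sup>2 = ?F * ?F + ?G * ?G + 2 * (?F * ?G) + 4 * (E * E + E * ?F + E * ?G)"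
    unfolding theta_square_tail_def E by (simp add: power2_eq_square algebra_simps)
  then have "4 dvd (?S\<^sup>2) $ n"
    by (simp add: FF FG GG numeral_fps_const)
  then have "64 dvd 16 * (?S\<^sup>2) $ n" by presburger
  moreover have "n \<noteq> 0" using n by auto
  ultimately show ?thesis
    by (subst overpartition_square_expand(3)) (simp add: S numeral_fps_const)
qed

section \<open>Congruences along nonsquares\<close>

text \<open>One term of the convolution. Let \<open>2\<^sup>e\<close> be the exact power of \<open>2\<close> in \<open>w\<close>; the factor \<open>w\<^sup>2\<close>
  contributes \<open>4\<^sup>e\<close>, so \<open>4\<^bsup>k-e\<^esup>\<close> must divide the coefficient of \<open>P\<^sup>2\<close> at \<open>j\<close>. For \<open>e < k - 1\<close> and \<open>e = 0\<close>
  the equation for \<open>j\<close> fails by parity. As the square of the odd part of \<open>w\<close> is \<open>1\<close> modulo \<open>8\<close>, the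
  other cases put \<open>j\<close> into the residue classes treated above.\<close>
lemma theta_term_divisible:
  fixes M w j k :: nat
  assumes "k \<in> {1, 2, 3, 4}" "\<nexists>s. M = s\<^sup>2" "0 < w" and N: "4 ^ (k - 1) * M = w\<^sup>2 + 2 * j"
  shows "2 ^ (2 * k) dvd int (w\<^sup>2) * (overpartition_fps\<^sup>2) $ j"
proof -
  let ?c = "(overpartition_fps\<^sup>2) $ j"
  define e where "e = multiplicity 2 w"
  obtain u where w: "w = 2 ^ e * u" "odd u"
    using multiplicity_decompose'[of w 2] assms(3) unfolding e_def by auto
  have four: "(4 :: nat) ^ i = (2 ^ i)\<^sup>2" for i
    by (simp add: power2_eq_square flip: power_mult_distrib)
  have w2: "w\<^sup>2 = 4 ^ e * u\<^sup>2" by (simp add: w(1) power_mult_distrib four)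
  obtain v where v: "u = 2 * v + 1" using w(2) by (auto elim: oddE)
  have "even (v * (v + 1))" by simp
  then obtain t where t: "v * (v + 1) = 2 * t" by (rule evenE)
  have u: "u\<^sup>2 = 8 * t + 1" using t unfolding v by (simp add: power2_eq_square algebra_simps)
  have j: "0 < j"
  proof (rule ccontr)
    assume "\<not> 0 < j"
    then have *: "(2 ^ (k - 1))\<^sup>2 * M = w\<^sup>2" using N by (simp add: four)
    then have "2 ^ (k - 1) dvd w" by (metis dvd_triv_left pow_divides_pow_iff zero_less_numeral)
    then obtain s where "w = 2 ^ (k - 1) * s" by auto
    then have "M = s\<^sup>2" using * by (simp add: power_mult_distrib)
    then show False using assms(2) by blast
  qed
  have reduce: ?thesis if "2 ^ (2 * (k - e)) dvd ?c"
  proof -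
    have "(2 :: int) ^ (2 * k) dvd 2 ^ (2 * e) * 2 ^ (2 * (k - e))"
      unfolding power_add[symmetric] by (intro le_imp_power_dvd) simp
    also have "\<dots> dvd int (w\<^sup>2) * ?c"
      using that by (intro mult_dvd_mono) (simp_all add: w2 power_mult)
    finally show ?thesis .
  qed
  \<comment> \<open>The bound \<open>k \<le> 4\<close> keeps \<open>4\<^bsup>k-e\<^esup>\<close> at most \<open>64\<close> once the parity cases \<open>e = 0\<close> are excluded.\<close>
  consider "k \<le> e" | "e = k - 1" | "k = 2" "e = 0" | "k = 3" "e = 0" | "k = 4" "e = 0"
    | "k = 3" "e = 1" | "k = 4" "e = 2" | "k = 4" "e = 1"
    using assms(1) by fastforce
  then show ?thesis
  proof cases
    case 1
    then show ?thesis by (intro reduce) simp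
  next
    case 2
    then have "k - e = 1" using assms(1) by auto
    then show ?thesis by (intro reduce) (simp add: overpartition_square_mod_4[OF j])
  next
    case 3
    then have "4 * M = 8 * t + 1 + 2 * j" using N unfolding w2 u by simp
    from arg_cong[OF this, of even] show ?thesis by simp
  next
    case 4
    then have "16 * M = 8 * t + 1 + 2 * j" using N unfolding w2 u by simp
    from arg_cong[OF this, of even] show ?thesis by simp
  next
    case 5
    then have "64 * M = 8 * t + 1 + 2 * j" using N unfolding w2 u by simp
    from arg_cong[OF this, of even] show ?thesis by simp
  next
    case 6
    then have "16 * M = 4 * (8 * t + 1) + 2 * j" using N unfolding w2 u by simp
    then have "j + 2 = 8 * (M - 2 * t)" by simp
    then have "8 dvd j + 2" by simp
    then have "j mod 8 = 6" by presburger
    then show ?thesis using 6 overpartition_square_mod_16[OF j] not_binary_square_form(1)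
      by (intro reduce) simp
  next
    case 7
    then have "64 * M = 16 * (8 * t + 1) + 2 * j" using N unfolding w2 u by simp
    then have "j + 8 = 32 * (M - 2 * t)" by simp
    then have "32 dvd j + 8" by simp
    then have "j mod 32 = 24" by presburger
    then show ?thesis using 7 overpartition_square_mod_16[OF j] not_binary_square_form(2)
      by (intro reduce) simp
  next
    case 8
    then have "64 * M = 4 * (8 * t + 1) + 2 * j" using N unfolding w2 u by simp
    then have "j + 2 = 16 * (2 * M - t)" by simp
    then have "16 dvd j + 2" by simp
    then have "j mod 16 = 14" by presburger
    then show ?thesis using 8 overpartition_square_mod_64
      by (intro reduce) simp
  qed
qed

lemma some_bar_nonsquare:
  fixes M k :: nat
  assumes "k \<in> {1, 2, 3, 4}" "\<nexists>s. M = s\<^sup>2"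
  shows "2 ^ (2 * k + 1) dvd some_bar (4 ^ (k - 1) * M)"
proof -
  let ?N = "4 ^ (k - 1) * M"
  have "2 ^ (2 * k + 1) dvd fps_XD theta_fps $ i * square_arg (overpartition_fps\<^sup>2) $ (?N - i)"
    if "i \<le> ?N" for i
  proof (cases "0 < i \<and> (\<exists>w. i = w\<^sup>2) \<and> even (?N - i)")
    case True
    then obtain w j where w: "i = w\<^sup>2" "0 < w" and j: "?N - i = 2 * j"
      by (metis evenE zero_power2 gr0I)
    then have "?N = w\<^sup>2 + 2 * j" using that by simp
    from theta_term_divisible[OF assms w(2) this]
    have "(2 :: int) * 2 ^ (2 * k) dvd 2 * (int (w\<^sup>2) * (overpartition_fps\<^sup>2) $ j)"
      by (rule mult_dvd_mono[OF dvd_refl])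
    moreover have "fps_XD theta_fps $ i = 2 * int (w\<^sup>2)"
      using w by (auto simp: fps_XD_nth theta_fps_nth)
    ultimately show ?thesis using j by (simp add: square_arg_nth mult.assoc)
  next
    case False
    then show ?thesis by (auto simp: fps_XD_nth theta_fps_nth square_arg_nth)
  qed
  then show ?thesis unfolding some_bar_theta fps_mult_nth by (intro dvd_sum) simp
qed

theorem corollary13:
  fixes p r n k :: nat
  assumes "prime p"
    and "r > 0"
    and "\<not> QuadRes (int p) (int r)"
    and "k \<in> {1, 2, 3, 4}"
  shows "[some_bar (4 ^ (k - 1) * (p * n + r)) = 0] (mod (2 ^ (2 * k + 1)))"
proof -
  have "p * n + r \<noteq> s\<^sup>2" for s
  proof
    assume "p * n + r = s\<^sup>2"
    then have "(int s)\<^sup>2 = int p * int n + int r" by (metis of_nat_add of_nat_mult of_nat_power)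
    then have "[(int s)\<^sup>2 = int r] (mod int p)" by (simp add: cong_def)
    then show False using assms(3) by (auto simp: QuadRes_def)
  qed
  then show ?thesis
    using some_bar_nonsquare[OF assms(4)] by (auto simp: cong_0_iff)
qed

end
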